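(* Consider the bases $[0312]$ (elements $A^{\uparrow\uparrow}_i,B^{\uparrow\uparrow}_i,\psi^{\uparrow\uparrow}_{i+1}$, $i\in\mathbb{N}$) and $[0321]$ (elements $A^{\downarrow\uparrow}_i,B^{\downarrow\uparrow}_i,\psi^{\downarrow\uparrow}_{i+1}$, $i\in\mathbb{N}$) of the Onsager Lie algebra $O$. The transition matrix from $[0312]$ to $[0321]$ is given, for $i\in\mathbb{N}$, by $$\begin{aligned} A^{\downarrow\uparrow}_i&=(-1)^{i+1}\sum_{j=0}^i\binom{i}{j}A^{\uparrow\uparrow}_j,\\ B^{\downarrow\uparrow}_i&=(-1)^i\sum_{j=0}^i\binom{i}{j}B^{\uparrow\uparrow}_j,\\ \psi^{\downarrow\uparrow}_{i+1}&=(-1)^i\sum_{j=0}^i\binom{i}{j}B^{\uparrow\uparrow}_j+(-1)^{i+1}\sum_{j=0}^i\binom{i}{j}\psi^{\uparrow\uparrow}_{j+1}. \end{aligned}$$ Moreover, the transition matrix from $[0321]$ to $[0312]$ is given, for $i\in\mathbb{N}$, by $$\begin{aligned} A^{\uparrow\uparrow}_i&=(-1)^{i+1}\sum_{j=0}^i\binom{i}{j}A^{\downarrow\uparrow}_j,\\ B^{\uparrow\uparrow}_i&=(-1)^i\sum_{j=0}^i\binom{i}{j}B^{\downarrow\uparrow}_j,\\ \psi^{\uparrow\uparrow}_{i+1}&=(-1)^i\sum_{j=0}^i\binom{i}{j}B^{\downarrow\uparrow}_j+(-1)^{i+1}\sum_{j=0}^i\binom{i}{j}\psi^{\downarrow\uparrow}_{j+1}.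 \end{aligned}$$
   Context: $\mathbb{F}$ is a field of characteristic zero; $\mathbb{N}=\{0,1,2,\ldots\}$; tensor products are over $\mathbb{F}$. $\mathfrak{sl}_2$ is the Lie algebra over $\mathbb{F}$ with basis $e,f,h$ and $[h,e]=2e$, $[h,f]=-2f$, $[e,f]=h$; $x=2e-h$, $y=-2f-h$, $z=h$ is its equitable basis. $\mathcal{A}=\mathbb{F}[t,t^{-1},(t-1)^{-1}]$ with $t$ an indeterminate. $L(\mathfrak{sl}_2)^+=\mathfrak{sl}_2\otimes\mathcal{A}$ with Lie bracket $[u\otimes a,v\otimes b]=[u,v]\otimes ab$ and right $\mathcal{A}$-module structure $(u\otimes a)b=u\otimes ab$. The Onsager Lie algebra $O$ (generators $A,B$; relations $[A,[A,[A,B]]]=4[A,B]$, $[B,[B,[B,A]]]=4[B,A]$) is identified with the Lie subalgebra of $L(\mathfrak{sl}_2)^+$ generated by $A=x\otimes1$ and $B=y\otimes t+z\otimes(t-1)$. Bases of $O$ (indexed by $i\in\mathbb{N}$): $[0312]$: $A^{\uparrow\uparrow}_i=x\otimes(t-1)^i$, $B^{\uparrow\uparrow}_i=(y\otimes t+z\otimes(t-1))(t-1)^i$, $\psi^{\uparrow\uparrow}_{i+1}=z\otimes(t-1)^{i+1}$. $[0321]$: $A^{\downarrow\uparrow}_i=-x\otimes(-t)^i$, $B^{\downarrow\uparrow}_i=(y\otimes t+z\otimes(t-1))(-t)^i$, $\psi^{\downarrow\uparrow}_{i+1}=-y\otimes(-t)^{i+1}$. The transition matrix from one basis to another is described by expressing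 each element of the second basis as a linear combination of the elements of the first. *)

theory Defs
  imports "HOL-Computational_Algebra.Polynomial_Factorial"
begin

section \<open>The algebra \<open>\<A> = \<F>[t, t\<^sup>-\<^sup>1, (t - 1)\<^sup>-\<^sup>1]\<close>\<close>

text \<open>
  The ground field of characteristic zero is the type variable \<open>'a\<close>. The algebra is realised inside
  the field of rational functions: it consists of the fractions whose denominator is a product of
  powers of \<open>t\<close> and \<open>t - 1\<close>.
\<close>

typedef (overloaded) 'a three_pt =
  "{r :: 'a :: field_char_0 poly fract. \<exists>p m n. r = Fract p ([:0, 1:] ^ m * [:-1, 1:] ^ n)}"
  morphisms fract_of_three_pt Abs_three_pt
proof -
  have "Fract 0 1 = (Fract 0 ([:0, 1:] ^ 0 * [:-1, 1:] ^ 0) :: 'a poly fract)" by simp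
  then show ?thesis by blast
qed

setup_lifting type_definition_three_pt

lemma den_nonzero: "[:0, 1:] ^ m * [:-1, 1:] ^ n \<noteq> (0 :: 'a :: field_char_0 poly)"
  by simp

lemma den_mult:
  "([:0, 1:] ^ m * [:-1, 1:] ^ n) * ([:0, 1:] ^ m' * [:-1, 1:] ^ n') =
     ([:0, 1:] ^ (m + m') * [:-1, 1:] ^ (n + n') :: 'a :: field_char_0 poly)"
  by (simp add: power_add mult_ac)

instantiation three_pt :: (field_char_0) comm_ring_1
begin

lift_definition zero_three_pt :: "'a three_pt" is 0
  by (rule exI[of _ 0], rule exI[of _ 0], rule exI[of _ 0]) (simp add: Zero_fract_def)

lift_definition one_three_pt :: "'a three_pt" is 1
  by (rule exI[of _ 1], rule exI[of _ 0], rule exI[of _ 0]) (simp add: One_fract_def)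

lift_definition plus_three_pt :: "'a three_pt \<Rightarrow> 'a three_pt \<Rightarrow> 'a three_pt" is "(+)"
  by (metis add_fract den_mult den_nonzero)

lift_definition uminus_three_pt :: "'a three_pt \<Rightarrow> 'a three_pt" is uminus
  by (metis minus_fract)

lift_definition minus_three_pt :: "'a three_pt \<Rightarrow> 'a three_pt \<Rightarrow> 'a three_pt" is "(-)"
  by (metis diff_fract den_mult den_nonzero)

lift_definition times_three_pt :: "'a three_pt \<Rightarrow> 'a three_pt \<Rightarrow> 'a three_pt" is "(*)"
  by (metis mult_fract den_mult)

instance
  by standard (transfer, simp add: algebra_simps)+

end

lift_definition const :: "'a :: field_char_0 \<Rightarrow> 'a three_pt" is "\<lambda>c. to_fract [:c:]"
  by (rule exI, rule exI[of _ 0], rule exI[of _ 0]) (simp add: to_fract_def)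

lift_definition t :: "'a :: field_char_0 three_pt" is "to_fract [:0, 1:]"
  by (rule exI, rule exI[of _ 0], rule exI[of _ 0]) (simp add: to_fract_def)

lemma const_0 [simp]: "const 0 = 0"
  by transfer simp

lemma const_1 [simp]: "const 1 = 1"
  by transfer (simp flip: one_pCons)

lemma const_add: "const (c + d) = const c + const d"
  by transfer (simp flip: to_fract_add)

lemma const_mult: "const (c * d) = const c * const d"
  by transfer (simp flip: to_fract_mult)

lemma t_unit: "t dvd (1 :: 'a :: field_char_0 three_pt)"
proof -
  have "\<exists>b :: 'a three_pt. 1 = t * b"
    by transfer
      (rule bexI[of _ "Fract 1 [:0, 1:]"],
       simp add: to_fract_def One_fract_def eq_fract,
       rule CollectI, rule exI[of _ 1], rule exI[of _ 1], rule exI[of _ 0], simp)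
  then show ?thesis by (simp add: dvd_def)
qed

lemma t_minus_1_unit: "t - 1 dvd (1 :: 'a :: field_char_0 three_pt)"
proof -
  have eq: "to_fract [:0, 1:] - 1 = (to_fract [:-1, 1:] :: 'a poly fract)"
    by (simp flip: to_fract_1 to_fract_diff add: one_pCons)
  have "\<exists>b :: 'a three_pt. 1 = (t - 1) * b"
    by transfer
      (rule bexI[of _ "Fract 1 [:-1, 1:]"],
       simp only: eq, simp add: to_fract_def One_fract_def eq_fract,
       rule CollectI, rule exI[of _ 1], rule exI[of _ 0], rule exI[of _ 1], simp)
  then show ?thesis by (simp add: dvd_def)
qed


section \<open>The Lie algebra \<open>\<s>\<l>\<^sub>2\<close>\<close>

text \<open>
  \<open>SL2 a b c\<close> stands for \<open>a e + b f + c h\<close>. The coefficients may lie in any commutative ring, so that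
  the same type serves for the Lie algebra over the ground field and for its extension of scalars.
\<close>

datatype 'r sl2 = SL2 (coeff_e: 'r) (coeff_f: 'r) (coeff_h: 'r)

instantiation sl2 :: (ab_group_add) ab_group_add
begin

definition "0 = SL2 0 0 0"
definition "u + v = SL2 (coeff_e u + coeff_e v) (coeff_f u + coeff_f v) (coeff_h u + coeff_h v)"
definition "- u = SL2 (- coeff_e u) (- coeff_f u) (- coeff_h u)"
definition "u - v = SL2 (coeff_e u - coeff_e v) (coeff_f u - coeff_f v) (coeff_h u - coeff_h v)"

instance
  by standard
    (auto simp: zero_sl2_def plus_sl2_def uminus_sl2_def minus_sl2_def algebra_simps sl2.expand)

end

definition sl2_scale :: "'r :: comm_ring_1 \<Rightarrow> 'r sl2 \<Rightarrow> 'r sl2" where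
  "sl2_scale r u = SL2 (r * coeff_e u) (r * coeff_f u) (r * coeff_h u)"

text \<open>The bilinear extension of \<open>[h, e] = 2 e\<close>, \<open>[h, f] = -2 f\<close>, \<open>[e, f] = h\<close>.\<close>

definition lie :: "'r :: comm_ring_1 sl2 \<Rightarrow> 'r sl2 \<Rightarrow> 'r sl2" where
  "lie u v = SL2
     (2 * (coeff_h u * coeff_e v - coeff_e u * coeff_h v))
     (- 2 * (coeff_h u * coeff_f v - coeff_f u * coeff_h v))
     (coeff_e u * coeff_f v - coeff_f u * coeff_e v)"

definition sl2_e :: "'r :: comm_ring_1 sl2" where "sl2_e = SL2 1 0 0"
definition sl2_f :: "'r :: comm_ring_1 sl2" where "sl2_f = SL2 0 1 0"
definition sl2_h :: "'r :: comm_ring_1 sl2" where "sl2_h = SL2 0 0 1"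

lemmas sl2_defs = zero_sl2_def plus_sl2_def uminus_sl2_def minus_sl2_def sl2_scale_def lie_def
  sl2_e_def sl2_f_def sl2_h_def

lemma lie_basis:
  "lie sl2_h sl2_e = sl2_scale 2 sl2_e"
  "lie sl2_h sl2_f = sl2_scale (- 2) sl2_f"
  "lie sl2_e sl2_f = sl2_h"
  by (simp_all add: sl2_defs)

lemma lie_self: "lie u u = 0"
  by (simp add: sl2_defs mult.commute)

lemma lie_jacobi: "lie u (lie v w) + lie v (lie w u) + lie w (lie u v) = 0"
  by (simp add: sl2_defs algebra_simps)

definition sl2_x :: "'r :: comm_ring_1 sl2" where "sl2_x = sl2_scale 2 sl2_e - sl2_h"
definition sl2_y :: "'r :: comm_ring_1 sl2" where "sl2_y = sl2_scale (- 2) sl2_f - sl2_h"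
definition sl2_z :: "'r :: comm_ring_1 sl2" where "sl2_z = sl2_h"


section \<open>The three-point loop algebra \<open>\<s>\<l>\<^sub>2 \<otimes> \<A>\<close>\<close>

text \<open>
  Since \<open>e, f, h\<close> is a basis, every element of the tensor product is uniquely of the form
  \<open>e \<otimes> a + f \<otimes> b + h \<otimes> c\<close>, which is represented by \<open>SL2 a b c\<close>. That this is the tensor product over
  the ground field is lemma \<open>tensor_universal\<close>; that \<open>lie\<close> is the required bracket is lemma \<open>lie_tensor\<close>.
\<close>

type_synonym 'a loop_sl2 = "'a three_pt sl2"

definition tensor :: "'a :: field_char_0 sl2 \<Rightarrow> 'a three_pt \<Rightarrow> 'a loop_sl2" (infixl "\<otimes>" 75) where
  "u \<otimes> a = SL2 (const (coeff_e u) * a) (const (coeff_f u) * a) (const (coeff_h u) * a)"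

definition scalar :: "'a :: field_char_0 \<Rightarrow> 'a loop_sl2 \<Rightarrow> 'a loop_sl2" where
  "scalar c w = sl2_scale (const c) w"

definition right_mult :: "'a :: field_char_0 loop_sl2 \<Rightarrow> 'a three_pt \<Rightarrow> 'a loop_sl2"
    (infixl "\<bullet>" 75) where
  "w \<bullet> b = sl2_scale b w"

global_interpretation loop: vector_space scalar
  by standard (simp_all add: scalar_def sl2_defs const_add const_mult algebra_simps)

lemma lie_tensor: "lie (u \<otimes> a) (v \<otimes> b) = lie u v \<otimes> (a * b)"
proof -
  have const_diff: "const (c - d) = const c - const d" for c d :: 'a
    by (metis const_add add_diff_cancel diff_add_cancel)
  have const_uminus: "const (- c) = - const c" for c :: 'a
    using const_diff[of 0 c] by simp
  have const_2: "const 2 = (2 :: 'a three_pt)"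
    by (metis const_1 const_add one_add_one)
  show ?thesis
    by (simp add: tensor_def lie_def const_mult const_diff const_uminus const_2 algebra_simps)
qed

lemma right_mult_tensor: "(u \<otimes> a) \<bullet> b = u \<otimes> (a * b)"
  by (simp add: tensor_def right_mult_def sl2_scale_def mult_ac)

lemma tensor_bilinear:
  "(u + v) \<otimes> a = u \<otimes> a + v \<otimes> a"
  "u \<otimes> (a + b) = u \<otimes> a + u \<otimes> b"
  "sl2_scale c u \<otimes> a = scalar c (u \<otimes> a)"
  "u \<otimes> (const c * a) = scalar c (u \<otimes> a)"
  by (simp_all add: tensor_def scalar_def sl2_defs const_add const_mult algebra_simps)

lemma tensor_universal:
  fixes s :: "'a :: field_char_0 \<Rightarrow> 'w :: ab_group_add \<Rightarrow> 'w"
    and \<phi> :: "'a sl2 \<Rightarrow> 'a three_pt \<Rightarrow> 'w"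
  assumes W: "vector_space s"
    and bilinear: "\<And>u v a. \<phi> (u + v) a = \<phi> u a + \<phi> v a"
      "\<And>u a b. \<phi> u (a + b) = \<phi> u a + \<phi> u b"
      "\<And>c u a. \<phi> (sl2_scale c u) a = s c (\<phi> u a)"
      "\<And>c u a. \<phi> u (const c * a) = s c (\<phi> u a)"
  shows "\<exists>!g. Vector_Spaces.linear scalar s g \<and> (\<forall>u a. g (u \<otimes> a) = \<phi> u a)"
proof (rule ex1I, intro conjI allI)
  interpret W: vector_space s by (rule W)
  let ?g = "\<lambda>w. \<phi> sl2_e (coeff_e w) + \<phi> sl2_f (coeff_f w) + \<phi> sl2_h (coeff_h w)"
  have split: "u = sl2_scale (coeff_e u) sl2_e + sl2_scale (coeff_f u) sl2_f
      + sl2_scale (coeff_h u) sl2_h" for u :: "'a sl2"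
    by (simp add: sl2_defs)
  show "Vector_Spaces.linear scalar s ?g"
    by unfold_locales
      (simp_all add: plus_sl2_def scalar_def sl2_scale_def bilinear W.scale_right_distrib)
  show "?g (u \<otimes> a) = \<phi> u a" for u a
  proof -
    have "\<phi> u a = \<phi> (sl2_scale (coeff_e u) sl2_e + sl2_scale (coeff_f u) sl2_f
        + sl2_scale (coeff_h u) sl2_h) a"
      by (simp flip: split)
    then show ?thesis by (simp add: tensor_def bilinear)
  qed
  fix g assume g: "Vector_Spaces.linear scalar s g \<and> (\<forall>u a. g (u \<otimes> a) = \<phi> u a)"
  then interpret g: Vector_Spaces.linear scalar s g by blast
  show "g = ?g"
  proof
    fix w :: "'a loop_sl2"
    have "w = sl2_e \<otimes> coeff_e w + sl2_f \<otimes> coeff_f w + sl2_h \<otimes> coeff_h w"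
      by (simp add: tensor_def sl2_defs)
    then have "g w = g (sl2_e \<otimes> coeff_e w + sl2_f \<otimes> coeff_f w + sl2_h \<otimes> coeff_h w)"
      by (rule arg_cong)
    then show "g w = ?g w" using g by (simp add: g.add)
  qed
qed


section \<open>The Onsager Lie algebra and its two bases\<close>

definition lie_subalgebra :: "'a :: field_char_0 loop_sl2 set \<Rightarrow> bool" where
  "lie_subalgebra S \<longleftrightarrow> loop.subspace S \<and> (\<forall>u\<in>S. \<forall>v\<in>S. lie u v \<in> S)"

definition ons_A :: "'a :: field_char_0 loop_sl2" where
  "ons_A = sl2_x \<otimes> 1"

definition ons_B :: "'a :: field_char_0 loop_sl2" where
  "ons_B = sl2_y \<otimes> t + sl2_z \<otimes> (t - 1)"

definition onsager :: "'a :: field_char_0 loop_sl2 set" where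
  "onsager = lie_subalgebra hull {ons_A, ons_B}"

text \<open>The \<open>\<psi>\<close>-elements are only used with positive index.\<close>

definition A_uu :: "nat \<Rightarrow> 'a :: field_char_0 loop_sl2" where
  "A_uu i = sl2_x \<otimes> (t - 1) ^ i"

definition B_uu :: "nat \<Rightarrow> 'a :: field_char_0 loop_sl2" where
  "B_uu i = (sl2_y \<otimes> t + sl2_z \<otimes> (t - 1)) \<bullet> (t - 1) ^ i"

definition psi_uu :: "nat \<Rightarrow> 'a :: field_char_0 loop_sl2" where
  "psi_uu i = sl2_z \<otimes> (t - 1) ^ i"

definition A_du :: "nat \<Rightarrow> 'a :: field_char_0 loop_sl2" where
  "A_du i = - (sl2_x \<otimes> (- t) ^ i)"

definition B_du :: "nat \<Rightarrow> 'a :: field_char_0 loop_sl2" where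
  "B_du i = (sl2_y \<otimes> t + sl2_z \<otimes> (t - 1)) \<bullet> (- t) ^ i"

definition psi_du :: "nat \<Rightarrow> 'a :: field_char_0 loop_sl2" where
  "psi_du i = - (sl2_y \<otimes> (- t) ^ i)"

datatype ons_index = Ind_A nat | Ind_B nat | Ind_psi nat

primrec basis_0312 :: "ons_index \<Rightarrow> 'a :: field_char_0 loop_sl2" where
  "basis_0312 (Ind_A i) = A_uu i"
| "basis_0312 (Ind_B i) = B_uu i"
| "basis_0312 (Ind_psi i) = psi_uu (i + 1)"

primrec basis_0321 :: "ons_index \<Rightarrow> 'a :: field_char_0 loop_sl2" where
  "basis_0321 (Ind_A i) = A_du i"
| "basis_0321 (Ind_B i) = B_du i"
| "basis_0321 (Ind_psi i) = psi_du (i + 1)"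

definition is_basis :: "('i \<Rightarrow> 'a :: field_char_0 loop_sl2) \<Rightarrow> 'a loop_sl2 set \<Rightarrow> bool" where
  "is_basis b V \<longleftrightarrow> inj b \<and> loop.independent (range b) \<and> loop.span (range b) = V"

end

theory Submission
  imports Defs
begin

text \<open>
  In \<open>sl2 \<otimes> \<A>\<close>, write \<open>P = \<F>[t]\<close>. The Onsager algebra is \<open>V = x \<otimes> P + y \<otimes> tP + z \<otimes> (t - 1)P\<close>.
  Indeed \<open>V\<close> is closed under the bracket since \<open>[x, y] = 2x + 2y\<close> and cyclically, and \<open>V\<close> is generated
  by \<open>A\<close> and \<open>B\<close>: bracketing the degree-\<open>i\<close> elements pairwise yields the three pairwise sums of the
  degree-\<open>(i + 1)\<close> elements, from which these are recovered as 2 is invertible. Both families consist of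
  the powers of a polynomial of degree one (\<open>t - 1\<close>, respectively \<open>-t\<close>) times three free \<open>P\<close>-module
  generators of \<open>V\<close>, so both are bases. As \<open>-t = -((t - 1) + 1)\<close> and \<open>t - 1 = -((-t) + 1)\<close>, the
  transition matrices come from the binomial theorem.
\<close>

section \<open>Polynomials inside the three-point algebra\<close>

definition of_poly :: "'a :: field_char_0 poly \<Rightarrow> 'a three_pt" where
  "of_poly p = Abs_three_pt (to_fract p)"

text \<open>A polynomial is a fraction with both denominator exponents zero. The algebraic laws of
  \<open>of_poly\<close> are then inherited from the fraction field, since
  \<open>fract_of_three_pt\<close> is injective.\<close>

lemma fract_of_poly [simp]: "fract_of_three_pt (of_poly p) = to_fract p"
  unfolding of_poly_def
proof (rule Abs_three_pt_inverse, rule CollectI, intro exI)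
  show "to_fract p = Fract p ([:0, 1:] ^ 0 * [:-1, 1:] ^ 0)" by (simp add: to_fract_def)
qed

lemma of_poly_0 [simp]: "of_poly 0 = 0"
  by (rule fract_of_three_pt_inject [THEN iffD1]) (simp add: zero_three_pt.rep_eq)

lemma of_poly_1 [simp]: "of_poly 1 = 1"
  by (rule fract_of_three_pt_inject [THEN iffD1]) (simp add: one_three_pt.rep_eq)

lemma of_poly_add: "of_poly (p + q) = of_poly p + of_poly q"
  by (rule fract_of_three_pt_inject [THEN iffD1]) (simp add: plus_three_pt.rep_eq)

lemma of_poly_diff: "of_poly (p - q) = of_poly p - of_poly q"
  by (rule fract_of_three_pt_inject [THEN iffD1]) (simp add: minus_three_pt.rep_eq)

lemma of_poly_minus: "of_poly (- p) = - of_poly p"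
  using of_poly_diff[of 0 p] by simp

lemma of_poly_mult: "of_poly (p * q) = of_poly p * of_poly q"
  by (rule fract_of_three_pt_inject [THEN iffD1]) (simp add: times_three_pt.rep_eq)

lemma of_poly_power: "of_poly (p ^ n) = of_poly p ^ n"
  by (induction n) (simp_all add: of_poly_mult)

lemma of_poly_const: "of_poly [:c:] = const c"
  by (rule fract_of_three_pt_inject [THEN iffD1]) (simp add: const.rep_eq)

lemma of_poly_smult: "of_poly (smult c p) = const c * of_poly p"
  by (simp flip: of_poly_const of_poly_mult)

lemma of_poly_sum: "of_poly (sum f S) = (\<Sum>i\<in>S. of_poly (f i))"
  by (induction S rule: infinite_finite_induct) (simp_all add: of_poly_add)

lemma of_poly_eq_0_iff [simp]: "of_poly p = 0 \<longleftrightarrow> p = 0"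
  by (metis fract_of_poly of_poly_0 to_fract_eq_iff)

lemma of_poly_X: "of_poly [:0, 1:] = t"
  by (rule fract_of_three_pt_inject [THEN iffD1]) (simp add: t.rep_eq)

lemma of_poly_X_minus_1: "of_poly [:-1, 1:] = t - 1"
proof -
  have "[:-1, 1:] = [:0, 1:] - (1 :: 'a poly)" by (simp add: one_pCons)
  then show ?thesis by (simp only: of_poly_diff of_poly_X of_poly_1)
qed

lemma const_uminus: "const (- c) = - const c"
  by (metis const_0 const_add add.right_inverse minus_unique)

lemma const_2 [simp]: "const 2 = 2"
  by (metis const_1 const_add one_add_one)

lemma const_of_nat: "const (of_nat n) = of_nat n"
  by (induction n) (simp_all add: const_add)

lemma const_minus_1_power: "const ((-1) ^ n) = (-1) ^ n"
  by (induction n) (simp_all add: const_mult const_uminus)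

text \<open>One half is taken from the ground field and acts through \<open>const\<close>; this is
  how the factor 2 is cancelled in coefficients.\<close>

lemma three_pt_half:
  fixes a :: "'a :: field_char_0 three_pt"
  shows "const (1 / 2) * (2 * a) = a"
proof -
  have "const (1 / 2) * (2 * a) = const (1 / 2 * 2) * a"
    by (simp only: const_mult const_2 mult.assoc)
  then show ?thesis by simp
qed

section \<open>Calculation rules for the right module structure and for tensors\<close>

lemma right_mult_simps:
  "w \<bullet> (a + b) = w \<bullet> a + w \<bullet> b" "(v + w) \<bullet> a = v \<bullet> a + w \<bullet> a"
  "w \<bullet> (const c * a) = scalar c (w \<bullet> a)" "w \<bullet> 0 = 0" "w \<bullet> 1 = w"
  "(v - w) \<bullet> a = v \<bullet> a - w \<bullet> a" "(- w) \<bullet> a = - (w \<bullet> a)"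
  by (simp_all add: right_mult_def scalar_def sl2_defs algebra_simps)

lemma right_mult_sum: "w \<bullet> sum f S = (\<Sum>i\<in>S. w \<bullet> f i)"
  by (induction S rule: infinite_finite_induct) (simp_all add: right_mult_simps)

lemma tensor_minus: "u \<otimes> (- a) = - (u \<otimes> a)"
  by (simp add: tensor_def uminus_sl2_def)

lemma tensor_xyz:
  "sl2_x \<otimes> a = SL2 (2 * a) 0 (- a)"
  "sl2_y \<otimes> a = SL2 0 (- (2 * a)) (- a)"
  "sl2_z \<otimes> a = SL2 0 0 a"
  by (simp_all add: tensor_def sl2_defs sl2_x_def sl2_y_def sl2_z_def const_uminus)

section \<open>Modules over \<open>F[t]\<close> with three generators\<close>

text \<open>Passing the coefficients through \<open>of_poly\<close> restricts scalars from the
  three-point algebra to \<open>F[t]\<close>: this is an \<open>F[t]\<close>-span, and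
  \<open>poly_free\<close> is linear independence over \<open>F[t]\<close>.\<close>

definition poly_module ::
    "'a :: field_char_0 loop_sl2 \<Rightarrow> 'a loop_sl2 \<Rightarrow> 'a loop_sl2 \<Rightarrow> 'a loop_sl2 set" where
  "poly_module X Y Z = {X \<bullet> of_poly p + Y \<bullet> of_poly q + Z \<bullet> of_poly r |p q r. True}"

definition poly_free ::
    "'a :: field_char_0 loop_sl2 \<Rightarrow> 'a loop_sl2 \<Rightarrow> 'a loop_sl2 \<Rightarrow> bool" where
  "poly_free X Y Z \<longleftrightarrow> (\<forall>p q r. X \<bullet> of_poly p + Y \<bullet> of_poly q + Z \<bullet> of_poly r = 0 \<longrightarrow>
     p = 0 \<and> q = 0 \<and> r = 0)"

lemma poly_moduleI: "X \<bullet> of_poly p + Y \<bullet> of_poly q + Z \<bullet> of_poly r \<in> poly_module X Y Z"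
  by (auto simp: poly_module_def)

lemma subspace_poly_module: "loop.subspace (poly_module X Y Z)"
proof (rule loop.subspaceI)
  show "0 \<in> poly_module X Y Z"
    using poly_moduleI[of X 0 Y 0 Z 0] by (simp add: right_mult_simps)
next
  fix v w assume "v \<in> poly_module X Y Z" "w \<in> poly_module X Y Z"
  then obtain p q r p' q' r' where
    "v = X \<bullet> of_poly p + Y \<bullet> of_poly q + Z \<bullet> of_poly r"
    "w = X \<bullet> of_poly p' + Y \<bullet> of_poly q' + Z \<bullet> of_poly r'"
    unfolding poly_module_def by blast
  then have "v + w = X \<bullet> of_poly (p + p') + Y \<bullet> of_poly (q + q') + Z \<bullet> of_poly (r + r')"
    by (simp add: of_poly_add right_mult_simps algebra_simps)
  then show "v + w \<in> poly_module X Y Z" by (simp only: poly_moduleI)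
next
  fix c v assume "v \<in> poly_module X Y Z"
  then obtain p q r where "v = X \<bullet> of_poly p + Y \<bullet> of_poly q + Z \<bullet> of_poly r"
    unfolding poly_module_def by blast
  then have "scalar c v =
      X \<bullet> of_poly (smult c p) + Y \<bullet> of_poly (smult c q) + Z \<bullet> of_poly (smult c r)"
    by (simp add: of_poly_smult right_mult_simps loop.scale_right_distrib)
  then show "scalar c v \<in> poly_module X Y Z" by (simp only: poly_moduleI)
qed

lemma poly_module_generators:
  "X \<bullet> of_poly p \<in> poly_module X Y Z"
  "Y \<bullet> of_poly p \<in> poly_module X Y Z"
  "Z \<bullet> of_poly p \<in> poly_module X Y Z"
  using poly_moduleI[of X p Y 0 Z 0] poly_moduleI[of X 0 Y p Z 0] poly_moduleI[of X 0 Y 0 Z p]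
  by (simp_all add: right_mult_simps)

section \<open>Bases made of powers of a degree-one polynomial\<close>

lemma pcompose_monom: "pcompose (monom c n) d = smult c (d ^ n)"
  by (induction n) (simp_all add: monom_0 monom_Suc pcompose_pCons)

lemma pcompose_eq_sum: "pcompose p d = (\<Sum>i\<le>degree p. smult (coeff p i) (d ^ i))"
  by (subst poly_as_sum_of_monoms [of p, symmetric]) (simp only: pcompose_sum pcompose_monom)

text \<open>Substituting \<open>a + b t\<close> is undone by substituting
  \<open>(t - a) / b\<close>. Hence the powers of \<open>d\<close> span all polynomials.\<close>

lemma degree_1_pcompose_surj:
  fixes d p :: "'a :: field poly"
  assumes "degree d = 1"
  obtains q where "p = pcompose q d"
proof -
  from assms obtain a b where d: "d = [:a, b:]" "b \<noteq> 0"
    by (cases d rule: degree1_coeffs)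
  have "pcompose (pcompose p [:- a / b, 1 / b:]) d = pcompose p (pcompose [:- a / b, 1 / b:] d)"
    by (rule pcompose_assoc [symmetric])
  also have "pcompose [:- a / b, 1 / b:] d = [:0, 1:]"
    using d by (simp add: pcompose_pCons)
  finally have "p = pcompose (pcompose p [:- a / b, 1 / b:]) d" by simp
  then show thesis by (rule that)
qed

lemma right_mult_of_poly_in_span:
  assumes "degree d = 1"
  shows "w \<bullet> of_poly p \<in> loop.span (range (\<lambda>i. w \<bullet> of_poly d ^ i))"
proof -
  obtain q where "p = pcompose q d" using degree_1_pcompose_surj[OF assms] .
  then have "w \<bullet> of_poly p = (\<Sum>i\<le>degree q. scalar (coeff q i) (w \<bullet> of_poly d ^ i))"
    by (simp add: pcompose_eq_sum of_poly_sum of_poly_smult of_poly_power right_mult_sum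
        right_mult_simps)
  then show ?thesis
    by (simp only:) (intro loop.span_sum loop.span_scale loop.span_base rangeI)
qed

text \<open>Independence stated over indices also yields injectivity: two indices with equal values
  would satisfy a relation with coefficients 1 and -1.\<close>

lemma is_basisI:
  assumes indep: "\<And>I g. finite I \<Longrightarrow> (\<Sum>i\<in>I. scalar (g i) (b i)) = 0 \<Longrightarrow> \<forall>i\<in>I. g i = 0"
    and span: "loop.span (range b) = V"
  shows "is_basis b V"
proof -
  have inj: "inj b"
  proof (rule injI, rule ccontr)
    fix i j assume eq: "b i = b j" and "i \<noteq> j"
    then have "(\<Sum>k\<in>{i, j}. scalar (if k = i then 1 else -1) (b k)) = 0" by simp
    then show False using indep[of "{i, j}" "\<lambda>k. if k = i then 1 else -1"] by auto
  qed
  have "loop.independent (range b)"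
    unfolding loop.independent_explicit_finite_subsets
  proof (intro allI impI)
    fix S u assume S: "S \<subseteq> range b" "finite S" and sum: "(\<Sum>v\<in>S. scalar (u v) v) = 0"
    obtain I where I: "S = b ` I" "finite I"
      using finite_subset_image[OF S(2,1)] by blast
    have "(\<Sum>i\<in>I. scalar (u (b i)) (b i)) = 0"
      using sum unfolding I by (subst (asm) sum.reindex) (auto intro: inj_on_subset[OF inj])
    then show "\<forall>v\<in>S. u v = 0" using indep[OF I(2), of "u \<circ> b"] I(1) by auto
  qed
  with inj span show ?thesis by (simp add: is_basis_def)
qed

text \<open>Collecting the relation by generator gives three polynomials evaluated at
  \<open>d\<close>. Freeness makes each value zero, and substitution of a nonconstant polynomial is
  injective.\<close>

lemma poly_free_independent:
  assumes free: "poly_free X Y Z" and d: "degree d = 1"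
    and I: "finite I" and sum: "(\<Sum>i\<in>I. scalar (g i) (case i of
      Ind_A n \<Rightarrow> X \<bullet> of_poly d ^ n | Ind_B n \<Rightarrow> Y \<bullet> of_poly d ^ n
    | Ind_psi n \<Rightarrow> Z \<bullet> of_poly d ^ n)) = 0"
  shows "\<forall>i\<in>I. g i = 0"
proof -
  define component where "component C = (\<Sum>i\<in>I. smult (g i) (C i))" for C :: "ons_index \<Rightarrow> 'a poly"
  \<comment> \<open>Each index contributes its monomial to exactly one of the three polynomials, so
    the coefficients of \<open>component CA\<close>, \<open>component CB\<close> and
    \<open>component CZ\<close> are the values of \<open>g\<close>.\<close>
  define CA CB CZ :: "ons_index \<Rightarrow> 'a poly" where
    "CA i = (case i of Ind_A n \<Rightarrow> monom 1 n | _ \<Rightarrow> 0)" and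
    "CB i = (case i of Ind_B n \<Rightarrow> monom 1 n | _ \<Rightarrow> 0)" and
    "CZ i = (case i of Ind_psi n \<Rightarrow> monom 1 n | _ \<Rightarrow> 0)" for i
  have scalar_sum: "w \<bullet> of_poly (pcompose (component C) d) =
      (\<Sum>i\<in>I. scalar (g i) (w \<bullet> of_poly (pcompose (C i) d)))" for w C
    by (simp add: component_def pcompose_sum pcompose_smult of_poly_sum of_poly_smult
        right_mult_sum right_mult_simps)
  have "X \<bullet> of_poly (pcompose (component CA) d) + Y \<bullet> of_poly (pcompose (component CB) d)
      + Z \<bullet> of_poly (pcompose (component CZ) d) = 0"
    \<comment> \<open>The three sums merge into one over \<open>I\<close>; for each index only one
      of the three terms survives, and it is the summand of \<open>sum\<close>.\<close>
    unfolding scalar_sum sum.distrib [symmetric] loop.scale_right_distrib [symmetric]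
    by (rule trans[OF sum.cong sum])
      (auto simp: CA_def CB_def CZ_def pcompose_monom of_poly_power right_mult_simps
        split: ons_index.split)
  then have "pcompose (component CA) d = 0 \<and> pcompose (component CB) d = 0
      \<and> pcompose (component CZ) d = 0"
    using free unfolding poly_free_def by blast
  then have zero: "component CA = 0" "component CB = 0" "component CZ = 0"
    using d by (auto dest: pcompose_eq_0)
  have "coeff (CA i) n = (if i = Ind_A n then 1 else 0)"
    "coeff (CB i) n = (if i = Ind_B n then 1 else 0)"
    "coeff (CZ i) n = (if i = Ind_psi n then 1 else 0)" for i n
    by (auto simp: CA_def CB_def CZ_def split: ons_index.split)
  then have "coeff (component CA) n = (if Ind_A n \<in> I then g (Ind_A n) else 0)"
    "coeff (component CB) n = (if Ind_B n \<in> I then g (Ind_B n) else 0)"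
    "coeff (component CZ) n = (if Ind_psi n \<in> I then g (Ind_psi n) else 0)" for n
    using I by (simp_all add: component_def coeff_sum if_distrib[of "\<lambda>c. _ * c"] cong: if_cong)
  then have "i \<in> I \<Longrightarrow> g i = 0" for i
    using zero by (cases i) (metis coeff_0)+
  then show ?thesis by blast
qed

text \<open>Freeness gives independence, and degree one gives spanning.\<close>

lemma is_basis_poly_module:
  assumes free: "poly_free X Y Z" and d: "degree d = 1"
    and b: "\<And>i. b (Ind_A i) = X \<bullet> of_poly d ^ i" "\<And>i. b (Ind_B i) = Y \<bullet> of_poly d ^ i"
      "\<And>i. b (Ind_psi i) = Z \<bullet> of_poly d ^ i"
  shows "is_basis b (poly_module X Y Z)"
proof (rule is_basisI)
  have b_eq: "b = (\<lambda>i. case i of Ind_A n \<Rightarrow> X \<bullet> of_poly d ^ n | Ind_B n \<Rightarrow> Y \<bullet> of_poly d ^ n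
      | Ind_psi n \<Rightarrow> Z \<bullet> of_poly d ^ n)"
    using b by (auto split: ons_index.split)
  show "finite I \<Longrightarrow> (\<Sum>i\<in>I. scalar (g i) (b i)) = 0 \<Longrightarrow> \<forall>i\<in>I. g i = 0" for I g
    using poly_free_independent[OF free d, of I g] unfolding b_eq by blast
  show "loop.span (range b) = poly_module X Y Z"
  proof (rule antisym)
    have "b i \<in> poly_module X Y Z" for i
      by (cases i) (simp_all only: b poly_module_generators flip: of_poly_power)
    then show "loop.span (range b) \<subseteq> poly_module X Y Z"
      by (intro loop.span_minimal subspace_poly_module) blast
  next
    have in_span: "w \<bullet> of_poly p \<in> loop.span (range b)"
      if "\<And>i. w \<bullet> of_poly d ^ i \<in> range b" for w p
      using right_mult_of_poly_in_span[OF d, of w p]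
        loop.span_mono[of "range (\<lambda>i. w \<bullet> of_poly d ^ i)" "range b"] that by blast
    have "X \<bullet> of_poly p \<in> loop.span (range b)" "Y \<bullet> of_poly p \<in> loop.span (range b)"
      "Z \<bullet> of_poly p \<in> loop.span (range b)" for p
      by (rule in_span, metis b rangeI)+
    then show "poly_module X Y Z \<subseteq> loop.span (range b)"
      unfolding poly_module_def by (auto intro!: loop.span_add)
  qed
qed

section \<open>The Onsager algebra as an \<open>F[t]\<close>-module\<close>

abbreviation onsager_module :: "'a :: field_char_0 loop_sl2 set" where
  "onsager_module \<equiv> poly_module (sl2_x \<otimes> 1) (sl2_y \<otimes> t) (sl2_z \<otimes> (t - 1))"

lemma lie_add_left: "lie (u + v) w = lie u w + lie v w"
  and lie_add_right: "lie w (u + v) = lie w u + lie w v"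
  by (simp_all add: sl2_defs algebra_simps)

lemma onsager_module_tensor:
  "sl2_x \<otimes> of_poly p \<in> onsager_module"
  "sl2_y \<otimes> (t * of_poly p) \<in> onsager_module"
  "sl2_z \<otimes> ((t - 1) * of_poly p) \<in> onsager_module"
  using poly_module_generators[where X="sl2_x \<otimes> 1" and Y="sl2_y \<otimes> t" and Z="sl2_z \<otimes> (t - 1)"]
  by (simp_all add: right_mult_tensor)

lemma onsager_module_cases:
  assumes "w \<in> onsager_module"
  obtains p q r where
    "w = sl2_x \<otimes> of_poly p + sl2_y \<otimes> (t * of_poly q) + sl2_z \<otimes> ((t - 1) * of_poly r)"
  using assms unfolding poly_module_def by (auto simp: right_mult_tensor)

text \<open>The relations of the equitable basis are cyclic in \<open>x\<close>, \<open>y\<close>,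
  \<open>z\<close>. Each right-hand side is kept as a sum of two scaled tensors so that subspace
  closure applies to each separately, and \<open>subspace_scale_2\<close> can strip the 2.\<close>

lemma lie_equitable:
  "lie (sl2_x \<otimes> a) (sl2_y \<otimes> b) = scalar 2 (sl2_x \<otimes> (a * b)) + scalar 2 (sl2_y \<otimes> (a * b))"
  "lie (sl2_y \<otimes> a) (sl2_z \<otimes> b) = scalar 2 (sl2_y \<otimes> (a * b)) + scalar 2 (sl2_z \<otimes> (a * b))"
  "lie (sl2_z \<otimes> a) (sl2_x \<otimes> b) = scalar 2 (sl2_z \<otimes> (a * b)) + scalar 2 (sl2_x \<otimes> (a * b))"
  by (simp_all add: tensor_xyz sl2_defs scalar_def algebra_simps)

lemma lie_commute: "lie u v = - lie v u"
  by (simp add: sl2_defs algebra_simps)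

text \<open>A bracket multiplies the coefficients, so a factor \<open>t\<close> attached to
  \<open>y\<close> or \<open>t - 1\<close> attached to \<open>z\<close> is still present in the
  product, as membership of the resulting \<open>y\<close> and \<open>z\<close> terms
  requires.\<close>

lemma lie_subalgebra_onsager_module: "lie_subalgebra onsager_module"
  unfolding lie_subalgebra_def
proof (intro conjI ballI subspace_poly_module)
  let ?M = "onsager_module :: 'a loop_sl2 set"
  note closed = loop.subspace_add[OF subspace_poly_module] loop.subspace_scale[OF subspace_poly_module]
    loop.subspace_0[OF subspace_poly_module]
  have xy: "lie (sl2_x \<otimes> of_poly p) (sl2_y \<otimes> (t * of_poly q)) \<in> ?M" for p q :: "'a poly"
    using onsager_module_tensor(1)[of "[:0, 1:] * p * q"] onsager_module_tensor(2)[of "p * q"]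
    unfolding lie_equitable
    by (intro closed) (simp_all only: of_poly_mult of_poly_X mult_ac)
  have yz: "lie (sl2_y \<otimes> (t * of_poly p)) (sl2_z \<otimes> ((t - 1) * of_poly q)) \<in> ?M" for p q :: "'a poly"
    using onsager_module_tensor(2)[of "[:-1, 1:] * p * q"] onsager_module_tensor(3)[of "[:0, 1:] * p * q"]
    unfolding lie_equitable
    by (intro closed) (simp_all only: of_poly_mult of_poly_X of_poly_X_minus_1 mult_ac)
  have zx: "lie (sl2_z \<otimes> ((t - 1) * of_poly p)) (sl2_x \<otimes> of_poly q) \<in> ?M" for p q :: "'a poly"
    using onsager_module_tensor(1)[of "[:-1, 1:] * p * q"] onsager_module_tensor(3)[of "p * q"]
    unfolding lie_equitable
    by (intro closed) (simp_all only: of_poly_mult of_poly_X_minus_1 mult_ac)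
  have same: "lie (u \<otimes> a) (u \<otimes> b) = 0" for u :: "'a sl2" and a b
    unfolding lie_tensor lie_self by (simp add: tensor_def zero_sl2_def)
  \<comment> \<open>The remaining three orders follow by antisymmetry.\<close>
  have yx: "lie (sl2_y \<otimes> (t * of_poly q)) (sl2_x \<otimes> of_poly p) \<in> ?M"
    and zy: "lie (sl2_z \<otimes> ((t - 1) * of_poly q)) (sl2_y \<otimes> (t * of_poly p)) \<in> ?M"
    and xz: "lie (sl2_x \<otimes> of_poly q) (sl2_z \<otimes> ((t - 1) * of_poly p)) \<in> ?M" for p q :: "'a poly"
    by (subst lie_commute, rule loop.subspace_neg[OF subspace_poly_module], rule xy yz zx)+
  fix u v assume uv: "u \<in> ?M" "v \<in> ?M"
  obtain p q r where u:
    "u = sl2_x \<otimes> of_poly p + sl2_y \<otimes> (t * of_poly q) + sl2_z \<otimes> ((t - 1) * of_poly r)"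
    using uv(1) by (rule onsager_module_cases)
  obtain p' q' r' where v:
    "v = sl2_x \<otimes> of_poly p' + sl2_y \<otimes> (t * of_poly q') + sl2_z \<otimes> ((t - 1) * of_poly r')"
    using uv(2) by (rule onsager_module_cases)
  show "lie u v \<in> ?M"
    unfolding u v lie_add_left lie_add_right same
    by (intro closed xy yz zx yx zy xz)
qed

lemma subspace_double:
  assumes S: "loop.subspace S" and "w + w \<in> S"
  shows "w \<in> S"
proof -
  have "scalar (1 / 2) (w + w) = scalar (1 / 2 + 1 / 2) w"
    by (simp only: loop.scale_left_distrib loop.scale_right_distrib)
  also have "\<dots> = w" by simp
  finally show ?thesis using loop.subspace_scale[OF assms, of "1 / 2"] by simp
qed

text \<open>\<open>(a + b) + (a + c) - (b + c) = 2 a\<close>, and 2 is invertible.\<close>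

lemma subspace_pair_sums:
  assumes S: "loop.subspace S" and ab: "a + b \<in> S" "b + c \<in> S" "a + c \<in> S"
  shows "a \<in> S" "b \<in> S" "c \<in> S"
proof -
  have "(a + b) + (a + c) - (b + c) \<in> S"
    by (rule loop.subspace_diff[OF S loop.subspace_add[OF S ab(1,3)] ab(2)])
  then show a: "a \<in> S" by (intro subspace_double[OF S, of a]) (simp add: algebra_simps)
  show "b \<in> S" "c \<in> S"
    using loop.subspace_diff[OF S ab(1) a] loop.subspace_diff[OF S ab(3) a] by simp_all
qed

lemma subspace_scale_2:
  assumes S: "loop.subspace S" and "scalar 2 a + scalar 2 b \<in> S"
  shows "a + b \<in> S"
  using loop.subspace_scale[OF S assms(2), of "1 / 2"] by (simp add: loop.scale_right_distrib)

text \<open>The case 0 splits \<open>B\<close> into its two tensors by means of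
  \<open>[A, B]\<close>. The induction step brackets with these degree-zero elements.\<close>

lemma lie_subalgebra_contains_powers:
  fixes S :: "'a :: field_char_0 loop_sl2 set"
  assumes L: "lie_subalgebra S" and A: "ons_A \<in> S" and B: "ons_B \<in> S"
  shows "sl2_x \<otimes> t ^ i \<in> S \<and> sl2_y \<otimes> (t * t ^ i) \<in> S \<and> sl2_z \<otimes> ((t - 1) * t ^ i) \<in> S"
proof (induction i)
  have S: "loop.subspace S" using L by (simp add: lie_subalgebra_def)
  have lie: "lie u v \<in> S" if "u \<in> S" "v \<in> S" for u v
    using L that by (auto simp: lie_subalgebra_def)
  have x0: "sl2_x \<otimes> 1 \<in> S" using A by (simp add: ons_A_def)
  have yz0: "sl2_y \<otimes> t + sl2_z \<otimes> (t - 1) \<in> S" using B by (simp add: ons_B_def)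
  \<comment> \<open>In the \<open>x\<close> component the contributions \<open>t\<close> and
    \<open>-(t - 1)\<close> add up to 1. Removing \<open>x\<close> leaves the difference of the two
    tensors whose sum is \<open>B\<close>.\<close>
  have AB: "lie ons_A ons_B = scalar 2 (sl2_x \<otimes> 1) + scalar 2 (sl2_y \<otimes> t - sl2_z \<otimes> (t - 1))"
    by (simp add: ons_A_def ons_B_def tensor_xyz sl2_defs scalar_def algebra_simps)
  have "sl2_x \<otimes> 1 + (sl2_y \<otimes> t - sl2_z \<otimes> (t - 1)) \<in> S"
    using lie[OF A B] unfolding AB by (rule subspace_scale_2[OF S])
  from loop.subspace_diff[OF S this x0] have diff: "sl2_y \<otimes> t - sl2_z \<otimes> (t - 1) \<in> S" by simp
  have y0: "sl2_y \<otimes> t \<in> S"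
    using loop.subspace_add[OF S yz0 diff] by (intro subspace_double[OF S, of "sl2_y \<otimes> t"]) simp
  have z0: "sl2_z \<otimes> (t - 1) \<in> S" using loop.subspace_diff[OF S yz0 y0] by simp
  {
    case 0
    show ?case using x0 y0 z0 by simp
  next
    case (Suc i)
    then have x: "sl2_x \<otimes> t ^ i \<in> S" and y: "sl2_y \<otimes> (t * t ^ i) \<in> S"
      and z: "sl2_z \<otimes> ((t - 1) * t ^ i) \<in> S" by auto
    \<comment> \<open>The \<open>y\<close> term of this bracket is already in \<open>S\<close> by
      the induction hypothesis, which isolates the next \<open>x\<close> element.\<close>
    have "sl2_x \<otimes> t ^ Suc i + sl2_y \<otimes> t ^ Suc i \<in> S"
      using lie[OF x y0] unfolding lie_equitable
      by (auto dest!: subspace_scale_2[OF S] simp: mult_ac)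
    from loop.subspace_diff[OF S this y[unfolded power_Suc[symmetric]]]
    have x1: "sl2_x \<otimes> t ^ Suc i \<in> S" by simp
    \<comment> \<open>For the pair sums, \<open>x\<close> carries the power \<open>i + 2\<close>,
      one more than the goal asks, to match \<open>y\<close>, whose coefficient has an extra
      \<open>t\<close>.\<close>
    have ab: "sl2_x \<otimes> t ^ Suc (Suc i) + sl2_y \<otimes> (t * t ^ Suc i) \<in> S"
      using lie[OF x1 y0] unfolding lie_equitable
      by (auto dest!: subspace_scale_2[OF S] simp: mult_ac)
    have "sl2_z \<otimes> ((t - 1) * t ^ Suc i) + sl2_x \<otimes> ((t - 1) * t ^ Suc i) \<in> S"
      using lie[OF z0 x1] unfolding lie_equitable
      by (auto dest!: subspace_scale_2[OF S] simp: mult_ac)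
    \<comment> \<open>Adding \<open>x1\<close> turns the coefficient
      \<open>(t - 1) * t ^ Suc i\<close> of \<open>x\<close> into \<open>t ^ Suc (Suc i)\<close>;
      adding \<open>y\<close> below does the same for the \<open>y\<close> term.\<close>
    from loop.subspace_add[OF S this x1]
    have ac: "sl2_x \<otimes> t ^ Suc (Suc i) + sl2_z \<otimes> ((t - 1) * t ^ Suc i) \<in> S"
      by (simp add: tensor_xyz sl2_defs algebra_simps)
    have "sl2_y \<otimes> (t * ((t - 1) * t ^ i)) + sl2_z \<otimes> (t * ((t - 1) * t ^ i)) \<in> S"
      using lie[OF y0 z] unfolding lie_equitable
      by (auto dest!: subspace_scale_2[OF S] simp: mult_ac)
    from loop.subspace_add[OF S this y]
    have bc: "sl2_y \<otimes> (t * t ^ Suc i) + sl2_z \<otimes> ((t - 1) * t ^ Suc i) \<in> S"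
      by (simp add: tensor_xyz sl2_defs algebra_simps)
    show ?case using x1 subspace_pair_sums[OF S ab bc ac] by blast
  }
qed

text \<open>The hull is minimal for one inclusion. For the other, any competing subalgebra contains
  the generators times all powers of \<open>t\<close>, hence times all polynomials.\<close>

lemma onsager_eq: "onsager = (onsager_module :: 'a :: field_char_0 loop_sl2 set)"
proof (rule antisym)
  have A: "ons_A \<in> (onsager_module :: 'a loop_sl2 set)"
    using onsager_module_tensor(1)[of 1] by (simp add: ons_A_def)
  have B: "ons_B \<in> (onsager_module :: 'a loop_sl2 set)"
    unfolding ons_B_def
    by (rule loop.subspace_add[OF subspace_poly_module])
      (use onsager_module_tensor(2,3)[of 1] in simp_all)
  show "onsager \<subseteq> (onsager_module :: 'a loop_sl2 set)"
    unfolding onsager_def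
    by (rule hull_minimal) (use A B lie_subalgebra_onsager_module in auto)
  show "onsager_module \<subseteq> (onsager :: 'a loop_sl2 set)"
    unfolding onsager_def hull_def
  proof (intro Inter_greatest)
    fix S :: "'a loop_sl2 set" assume "S \<in> {S. lie_subalgebra S \<and> {ons_A, ons_B} \<subseteq> S}"
    then have L: "lie_subalgebra S" and "ons_A \<in> S" "ons_B \<in> S" by auto
    note powers = lie_subalgebra_contains_powers[OF this]
    have S: "loop.subspace S" using L by (simp add: lie_subalgebra_def)
    have in_S: "w \<bullet> of_poly p \<in> S" if "\<And>i. w \<bullet> t ^ i \<in> S" for w p
      using right_mult_of_poly_in_span[of "[:0, 1:]" w p] that
        loop.span_minimal[OF _ S, of "range (\<lambda>i. w \<bullet> t ^ i)"]
      by (auto simp: of_poly_X)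
    have "sl2_x \<otimes> 1 \<bullet> of_poly p \<in> S" "sl2_y \<otimes> t \<bullet> of_poly p \<in> S"
      "sl2_z \<otimes> (t - 1) \<bullet> of_poly p \<in> S" for p
      by (rule in_S, use powers in \<open>simp add: right_mult_tensor\<close>)+
    then show "onsager_module \<subseteq> S"
      unfolding poly_module_def by (auto intro!: loop.subspace_add[OF S])
  qed
qed

section \<open>Free generators adapted to the two bases\<close>

text \<open>Only \<open>x\<close> has an \<open>e\<close> part and only \<open>y\<close> an
  \<open>f\<close> part, so these vanish first and the \<open>h\<close> part settles
  \<open>z\<close>. The factors \<open>t\<close> and \<open>t - 1\<close> are cancelled among
  polynomials, using injectivity of \<open>of_poly\<close>.\<close>

lemma poly_free_equitable: "poly_free (sl2_x \<otimes> 1) (sl2_y \<otimes> t) (sl2_z \<otimes> (t - 1))"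
  unfolding poly_free_def
proof (intro allI impI)
  fix p q r :: "'a poly"
  have two: "a = 0" if "2 * a = 0" for a :: "'a three_pt"
    using three_pt_half[of a] that by simp
  assume "(sl2_x \<otimes> 1) \<bullet> of_poly p + (sl2_y \<otimes> t) \<bullet> of_poly q + (sl2_z \<otimes> (t - 1)) \<bullet> of_poly r = 0"
  then have eqs: "2 * of_poly p = 0" "2 * (t * of_poly q) = 0"
    "(t - 1) * of_poly r - t * of_poly q - of_poly p = 0"
    unfolding right_mult_tensor by (simp_all add: tensor_xyz plus_sl2_def zero_sl2_def algebra_simps)
  from eqs(1) have p: "p = 0" using two by force
  from two[OF eqs(2)] have "of_poly ([:0, 1:] * q) = 0" by (simp only: of_poly_mult of_poly_X)
  then have q: "q = 0" by (simp only: of_poly_eq_0_iff mult_eq_0_iff) simp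
  from eqs(3) p q have "of_poly ([:-1, 1:] * r) = 0"
    by (simp only: of_poly_mult of_poly_X_minus_1) simp
  then have r: "r = 0" by (simp only: of_poly_eq_0_iff mult_eq_0_iff) simp
  show "p = 0 \<and> q = 0 \<and> r = 0" using p q r by blast
qed

text \<open>An invertible change of generators over \<open>F[t]\<close>; it makes
  \<open>B = y t + z (t - 1)\<close> one of them.\<close>

lemma poly_free_shear:
  assumes "poly_free X Y Z"
  shows "poly_free X (Y + Z) Z" "poly_module X (Y + Z) Z = poly_module X Y Z"
proof -
  have eq: "X \<bullet> of_poly p + (Y + Z) \<bullet> of_poly q + Z \<bullet> of_poly r =
      X \<bullet> of_poly p + Y \<bullet> of_poly q + Z \<bullet> of_poly (q + r)" for p q r
    by (simp add: right_mult_simps of_poly_add add_ac)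
  show "poly_free X (Y + Z) Z"
    using assms unfolding poly_free_def eq by (metis add.left_neutral)
  show "poly_module X (Y + Z) Z = poly_module X Y Z"
    unfolding poly_module_def eq
  proof (safe, goal_cases)
    case (2 _ p q r)
    \<comment> \<open>The inverse shear replaces the coefficients \<open>q\<close>, \<open>r\<close>
      by \<open>q\<close>, \<open>r - q\<close>.\<close>
    have "r = q + (r - q)" by simp
    then show ?case by metis
  qed blast
qed

text \<open>Prepares [0321], where \<open>A\<close> changes sign and the third generator comes from
  \<open>y\<close> instead of \<open>z\<close>. A subsequent shear gives the same
  \<open>B\<close>.\<close>

lemma poly_free_swap:
  assumes "poly_free X Y Z"
  shows "poly_free (- X) Z Y" "poly_module (- X) Z Y = poly_module X Y Z"
proof -
  have eq: "- X \<bullet> of_poly p + Z \<bullet> of_poly q + Y \<bullet> of_poly r =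
      X \<bullet> of_poly (- p) + Y \<bullet> of_poly r + Z \<bullet> of_poly q" for p q r
    by (simp add: right_mult_def sl2_defs of_poly_minus)
  show "poly_free (- X) Z Y"
    using assms unfolding poly_free_def eq by (metis neg_equal_0_iff_equal)
  have "\<exists>p'. p = - p'" for p :: "'a poly" by (metis minus_minus)
  then show "poly_module (- X) Z Y = poly_module X Y Z"
    unfolding poly_module_def eq by (metis (no_types))
qed

text \<open>The third generator already contains one factor \<open>t - 1\<close>, which matches the
  index shift in \<open>psi_uu (i + 1)\<close>.\<close>

lemma is_basis_0312: "is_basis basis_0312 (onsager :: 'a :: field_char_0 loop_sl2 set)"
proof -
  note free = poly_free_equitable[where 'a = 'a]
  show ?thesis
    unfolding onsager_eq poly_free_shear(2)[OF free, symmetric]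
    by (rule is_basis_poly_module[where d = "[:-1, 1:]", OF poly_free_shear(1)[OF free]])
      (simp_all add: of_poly_X_minus_1 A_uu_def B_uu_def psi_uu_def right_mult_tensor)
qed

text \<open>The minus sign of \<open>psi_du\<close> absorbs one factor \<open>-t\<close> into
  \<open>t\<close>, so \<open>psi_du (i + 1)\<close> is the generator \<open>y t\<close> times
  \<open>(- t) ^ i\<close>.\<close>

lemma is_basis_0321: "is_basis basis_0321 (onsager :: 'a :: field_char_0 loop_sl2 set)"
proof -
  note free = poly_free_equitable[where 'a = 'a]
  note swap = poly_free_swap[OF free]
  have d: "of_poly [:0, -1:] = (- t :: 'a three_pt)"
    by (simp flip: of_poly_X of_poly_minus)
  show ?thesis
    unfolding onsager_eq swap(2)[symmetric] poly_free_shear(2)[OF swap(1), symmetric]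
    by (rule is_basis_poly_module[where d = "[:0, -1:]", OF poly_free_shear(1)[OF swap(1)]])
      (simp_all add: d A_du_def B_du_def psi_du_def right_mult_tensor right_mult_simps add.commute
        tensor_minus)
qed

section \<open>Transition matrices\<close>

text \<open>The involution sending \<open>a\<close> to \<open>- (a + 1)\<close> exchanges
  \<open>t - 1\<close> and \<open>- t\<close>, so one expansion serves both directions.\<close>

lemma right_mult_binomial:
  "w \<bullet> (- (a + 1)) ^ i =
     scalar ((-1) ^ i) (\<Sum>j=0..i. scalar (of_nat (i choose j)) (w \<bullet> a ^ j))"
proof -
  have "(- (a + 1)) ^ i = const ((-1) ^ i) * (\<Sum>j=0..i. const (of_nat (i choose j)) * a ^ j)"
    by (subst power_minus) (simp add: const_minus_1_power const_of_nat binomial_ring atLeast0AtMost)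
  then show ?thesis by (simp only: right_mult_simps right_mult_sum)
qed

theorem lemma11p3:
  shows
    "is_basis basis_0312 (onsager :: 'a :: field_char_0 loop_sl2 set) \<and>
     is_basis basis_0321 (onsager :: 'a loop_sl2 set) \<and>
     (\<forall>i.
       (A_du i :: 'a loop_sl2) =
         scalar ((-1) ^ (i + 1)) (\<Sum>j=0..i. scalar (of_nat (i choose j)) (A_uu j)) \<and>
       (B_du i :: 'a loop_sl2) =
         scalar ((-1) ^ i) (\<Sum>j=0..i. scalar (of_nat (i choose j)) (B_uu j)) \<and>
       (psi_du (i + 1) :: 'a loop_sl2) =
         scalar ((-1) ^ i) (\<Sum>j=0..i. scalar (of_nat (i choose j)) (B_uu j)) +
         scalar ((-1) ^ (i + 1)) (\<Sum>j=0..i. scalar (of_nat (i choose j)) (psi_uu (j + 1)))) \<and>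
     (\<forall>i.
       (A_uu i :: 'a loop_sl2) =
         scalar ((-1) ^ (i + 1)) (\<Sum>j=0..i. scalar (of_nat (i choose j)) (A_du j)) \<and>
       (B_uu i :: 'a loop_sl2) =
         scalar ((-1) ^ i) (\<Sum>j=0..i. scalar (of_nat (i choose j)) (B_du j)) \<and>
       (psi_uu (i + 1) :: 'a loop_sl2) =
         scalar ((-1) ^ i) (\<Sum>j=0..i. scalar (of_nat (i choose j)) (B_du j)) +
         scalar ((-1) ^ (i + 1)) (\<Sum>j=0..i. scalar (of_nat (i choose j)) (psi_du (j + 1))))"
proof (intro conjI allI is_basis_0312 is_basis_0321)
  fix i
  have t_eq: "- t = - ((t - 1 :: 'a three_pt) + 1)" and s_eq: "t - 1 = - (- t + 1 :: 'a three_pt)"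
    by simp_all
  have A: "A_uu j = (sl2_x \<otimes> 1) \<bullet> (t - 1) ^ j" "A_du j = - ((sl2_x \<otimes> 1) \<bullet> (- t) ^ j)" for j
    by (simp_all add: A_uu_def A_du_def right_mult_tensor)
  have psi: "psi_uu (j + 1) = (sl2_z \<otimes> (t - 1)) \<bullet> (t - 1) ^ j"
    "psi_du (j + 1) = (sl2_y \<otimes> t) \<bullet> (- t) ^ j" for j
    by (simp_all add: psi_uu_def psi_du_def right_mult_tensor tensor_minus)
  note binom_t = right_mult_binomial[of _ "t - 1 :: 'a three_pt" i, folded t_eq]
  note binom_s = right_mult_binomial[of _ "- t :: 'a three_pt" i, folded s_eq]
  \<comment> \<open>Each \<open>psi\<close> is \<open>B\<close> minus the other of its two tensors.
    Expanding that tensor in powers of the opposite variable gives the \<open>psi\<close> elements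
    of the other basis, which explains the two sums in the \<open>psi\<close> rows.\<close>
  have psi_diff: "psi_du (j + 1) = B_du j - (sl2_z \<otimes> (t - 1)) \<bullet> (- t) ^ j"
    "psi_uu (j + 1) = B_uu j - (sl2_y \<otimes> t) \<bullet> (t - 1) ^ j" for j
    unfolding psi B_du_def B_uu_def by (simp_all add: right_mult_simps)
  \<comment> \<open>The sign in the definition of \<open>A_du\<close> raises the exponent of -1 to
    \<open>i + 1\<close>, here and in the inverse direction.\<close>
  show "(A_du i :: 'a loop_sl2) =
      scalar ((-1) ^ (i + 1)) (\<Sum>j=0..i. scalar (of_nat (i choose j)) (A_uu j))"
    by (simp add: A binom_t)
  show "(A_uu i :: 'a loop_sl2) =
      scalar ((-1) ^ (i + 1)) (\<Sum>j=0..i. scalar (of_nat (i choose j)) (A_du j))"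
    by (simp add: A binom_s sum_negf)
  show B: "(B_du i :: 'a loop_sl2) =
      scalar ((-1) ^ i) (\<Sum>j=0..i. scalar (of_nat (i choose j)) (B_uu j))"
    unfolding B_du_def B_uu_def by (rule binom_t)
  show B': "(B_uu i :: 'a loop_sl2) =
      scalar ((-1) ^ i) (\<Sum>j=0..i. scalar (of_nat (i choose j)) (B_du j))"
    unfolding B_du_def B_uu_def by (rule binom_s)
  show "(psi_du (i + 1) :: 'a loop_sl2) =
      scalar ((-1) ^ i) (\<Sum>j=0..i. scalar (of_nat (i choose j)) (B_uu j)) +
      scalar ((-1) ^ (i + 1)) (\<Sum>j=0..i. scalar (of_nat (i choose j)) (psi_uu (j + 1)))"
    unfolding psi_diff(1) B unfolding psi binom_t by simp
  show "(psi_uu (i + 1) :: 'a loop_sl2) =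
      scalar ((-1) ^ i) (\<Sum>j=0..i. scalar (of_nat (i choose j)) (B_du j)) +
      scalar ((-1) ^ (i + 1)) (\<Sum>j=0..i. scalar (of_nat (i choose j)) (psi_du (j + 1)))"
    unfolding psi_diff(2) B' unfolding psi binom_s by simp
qed

end
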